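(* Let $\rho$ be a density matrix on a finite-dimensional bipartite Hilbert space $\mathcal H^{\rm A}\otimes\mathcal H^{\rm B}$, and let $U^{\rm A}$ and $U^{\rm B}$ be unitary operators on $\mathcal H^{\rm A}$ and $\mathcal H^{\rm B}$ respectively. Then $$M\bigl((U^{\rm A}\otimes U^{\rm B})\,\rho\,(U^{\rm A}\otimes U^{\rm B})^\dagger\bigr)=M(\rho).$$
   Context: A density matrix is a positive semidefinite Hermitian matrix of trace one. Definition of $M$ for a density matrix $\rho^{\rm AB}$ on $\mathcal H^{\rm A}\otimes\mathcal H^{\rm B}$. For $x,y\ge0$ let ${\rm nim}_y(x)$ be the nearest integer multiple of $y$ to $x$, ties rounded down: ${\rm nim}_0(x)=0$, and for $y\neq0$, ${\rm nim}_y(x)=y\lfloor x/y\rfloor$ if $x-y\lfloor x/y\rfloor\le y\lceil x/y\rceil-x$, and ${\rm nim}_y(x)=y\lceil x/y\rceil$ otherwise. Let $\eta_1,\dots,\eta_m$ be the distinct eigenvalues of $\rho^{\rm AB}$, let $d^{\eta_j}$ be the dimension of the $\eta_j$-eigenspace, and let $\tilde\rho^{\eta_j}$ be $\eta_j$ times the orthogonal projector onto the $\eta_j$-eigenspace, so $\rho^{\rm AB}=\sum_j\tilde\rho^{\eta_j}$. Let $\lambda_i^{j,{\rm A}}$, $i=1,\dots,d_j^{\rm A}$, be the nonzero eigenvalues, with multiplicity, of ${\rm Tr}_{\rm B}\tilde\rho^{\eta_j}$, where $d_j^{\rm A}$ is its rank (an eigenvalue $\eta_j=0$ contributes an empty sum).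 Define $$M^{\rm A}(\rho^{\rm AB})=-\sum_{j=1}^m\sum_{i=1}^{d_j^{\rm A}}\left|\lambda_i^{j,{\rm A}}-{\rm nim}_{\eta_j}(\lambda_i^{j,{\rm A}})\right|\log_2\frac{\lambda_i^{j,{\rm A}}}{\eta_jd^{\eta_j}}.$$ $M^{\rm B}(\rho^{\rm AB})$ is defined in the same way using the nonzero eigenvalues $\lambda_i^{j,{\rm B}}$ of ${\rm Tr}_{\rm A}\tilde\rho^{\eta_j}$. Finally $M(\rho^{\rm AB})=\frac12[M^{\rm A}(\rho^{\rm AB})+M^{\rm B}(\rho^{\rm AB})]$. *)

theory Defs
  imports "HOL-Analysis.Analysis" "HOL-Library.Multiset"
begin

section \<open>Complex matrices\<close>

text \<open>
  A finite-dimensional Hilbert space is \<open>complex ^ 'a\<close> with its standard Hermitian inner product,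
  where \<open>'a\<close> is an arbitrary finite index type. The tensor product of \<open>complex ^ 'a\<close> and
  \<open>complex ^ 'b\<close> is \<open>complex ^ ('a \<times> 'b)\<close>.
\<close>

definition cinner :: "complex ^ 'n \<Rightarrow> complex ^ 'n \<Rightarrow> complex" where
  "cinner x y = (\<Sum>i\<in>UNIV. cnj (x $ i) * y $ i)"

definition dagger :: "complex ^ 'n ^ 'm \<Rightarrow> complex ^ 'm ^ 'n" where
  "dagger A = (\<chi> i j. cnj (A $ j $ i))"

definition hermitian :: "complex ^ 'n ^ 'n \<Rightarrow> bool" where
  "hermitian A \<longleftrightarrow> dagger A = A"

definition unitary :: "complex ^ 'n ^ 'n \<Rightarrow> bool" where
  "unitary U \<longleftrightarrow> dagger U ** U = mat 1 \<and> U ** dagger U = mat 1"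

definition pos_semidef :: "complex ^ 'n ^ 'n \<Rightarrow> bool" where
  "pos_semidef A \<longleftrightarrow> hermitian A \<and> (\<forall>x. 0 \<le> Re (cinner x (A *v x)))"

definition density_matrix :: "complex ^ 'n ^ 'n \<Rightarrow> bool" where
  "density_matrix \<rho> \<longleftrightarrow> pos_semidef \<rho> \<and> trace \<rho> = 1"

definition tensor ::
    "complex ^ 'a ^ 'a \<Rightarrow> complex ^ 'b ^ 'b \<Rightarrow> complex ^ ('a::finite \<times> 'b::finite) ^ ('a \<times> 'b)"
    (infixl "\<otimes>" 75) where
  "A \<otimes> B = (\<chi> p q. A $ fst p $ fst q * B $ snd p $ snd q)"

definition Tr_A :: "complex ^ ('a::finite \<times> 'b::finite) ^ ('a \<times> 'b) \<Rightarrow> complex ^ 'b ^ 'b" where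
  "Tr_A R = (\<chi> j l. \<Sum>i\<in>UNIV. R $ (i, j) $ (i, l))"

definition Tr_B :: "complex ^ ('a::finite \<times> 'b::finite) ^ ('a \<times> 'b) \<Rightarrow> complex ^ 'a ^ 'a" where
  "Tr_B R = (\<chi> i k. \<Sum>j\<in>UNIV. R $ (i, j) $ (k, j))"


section \<open>Spectral data\<close>

definition eigenspace :: "complex ^ 'n ^ 'n \<Rightarrow> real \<Rightarrow> (complex ^ 'n) set" where
  "eigenspace A \<eta> = {v. A *v v = complex_of_real \<eta> *s v}"

text \<open>
  Eigenvalues are taken to be real numbers: below they are only used for Hermitian matrices, all
  of whose eigenvalues are real.
\<close>

definition eigenvalues :: "complex ^ 'n ^ 'n \<Rightarrow> real set" where
  "eigenvalues A = {\<eta>. \<exists>v. v \<noteq> 0 \<and> A *v v = complex_of_real \<eta> *s v}"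

text \<open>\<open>vec.dim\<close> is the dimension over the complex numbers; plain \<open>dim\<close> would be the real one.\<close>

definition eigendim :: "complex ^ 'n ^ 'n \<Rightarrow> real \<Rightarrow> nat" where
  "eigendim A \<eta> = vec.dim (eigenspace A \<eta>)"

text \<open>
  For Hermitian matrices geometric and algebraic multiplicities agree, and the size of the
  following multiset is the rank.
\<close>

definition nonzero_eigenvalues :: "complex ^ 'n ^ 'n \<Rightarrow> real multiset" where
  "nonzero_eigenvalues A = (\<Sum>\<eta>\<in>eigenvalues A - {0}. replicate_mset (eigendim A \<eta>) \<eta>)"

definition is_orth_projector :: "complex ^ 'n ^ 'n \<Rightarrow> (complex ^ 'n) set \<Rightarrow> bool" where
  "is_orth_projector P E \<longleftrightarrow> hermitian P \<and> P ** P = P \<and> range (\<lambda>x. P *v x) = E"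

definition orth_projector :: "(complex ^ 'n) set \<Rightarrow> complex ^ 'n ^ 'n" where
  "orth_projector E = (THE P. is_orth_projector P E)"

definition spectral_part :: "complex ^ 'n ^ 'n \<Rightarrow> real \<Rightarrow> complex ^ 'n ^ 'n" where
  "spectral_part \<rho> \<eta> = \<eta> *\<^sub>R orth_projector (eigenspace \<rho> \<eta>)"


section \<open>The quantity \<open>M\<close>\<close>

definition nim :: "real \<Rightarrow> real \<Rightarrow> real" where
  "nim y x =
    (if y = 0 then 0
     else if x - y * of_int \<lfloor>x / y\<rfloor> \<le> y * of_int \<lceil>x / y\<rceil> - x
     then y * of_int \<lfloor>x / y\<rfloor>
     else y * of_int \<lceil>x / y\<rceil>)"

text \<open>
  The eigenvalue \<open>\<eta> = 0\<close> needs no special treatment: its spectral part is the zero matrix, which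
  has no nonzero eigenvalues.
\<close>

definition M_A :: "complex ^ ('a::finite \<times> 'b::finite) ^ ('a \<times> 'b) \<Rightarrow> real" where
  "M_A \<rho> = - (\<Sum>\<eta>\<in>eigenvalues \<rho>. \<Sum>\<mu>\<in>#nonzero_eigenvalues (Tr_B (spectral_part \<rho> \<eta>)).
      \<bar>\<mu> - nim \<eta> \<mu>\<bar> * log 2 (\<mu> / (\<eta> * real (eigendim \<rho> \<eta>))))"

definition M_B :: "complex ^ ('a::finite \<times> 'b::finite) ^ ('a \<times> 'b) \<Rightarrow> real" where
  "M_B \<rho> = - (\<Sum>\<eta>\<in>eigenvalues \<rho>. \<Sum>\<mu>\<in>#nonzero_eigenvalues (Tr_A (spectral_part \<rho> \<eta>)).
      \<bar>\<mu> - nim \<eta> \<mu>\<bar> * log 2 (\<mu> / (\<eta> * real (eigendim \<rho> \<eta>))))"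

definition M :: "complex ^ ('a::finite \<times> 'b::finite) ^ ('a \<times> 'b) \<Rightarrow> real" where
  "M \<rho> = 1 / 2 * (M_A \<rho> + M_B \<rho>)"

end

theory Submission imports Defs begin

text \<open>
  Conjugation by a unitary \<open>W\<close> preserves the eigenvalues and maps eigenspaces by \<open>W\<close>, so by
  uniqueness of orthogonal projectors it conjugates the spectral parts by \<open>W\<close>. For
  \<open>W = U\<^sub>A \<otimes> U\<^sub>B\<close> the partial trace over one factor absorbs the unitary on that factor and leaves
  the conjugation by the other one, which again does not change the eigenvalues.
\<close>

section \<open>Adjoints and unitary conjugation\<close>

lemma dagger_dagger [simp]: "dagger (dagger A) = A"
  by (simp add: dagger_def vec_eq_iff)

lemma dagger_matrix_mult: "dagger (A ** B) = dagger B ** dagger A"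
  by (simp add: dagger_def matrix_matrix_mult_def vec_eq_iff mult.commute)

lemma cinner_dagger: "cinner x (A *v y) = cinner (dagger A *v x) y"
proof -
  have "cinner x (A *v y) = (\<Sum>i\<in>UNIV. \<Sum>j\<in>UNIV. cnj (x $ i) * (A $ i $ j * y $ j))"
    by (simp add: cinner_def matrix_vector_mult_def sum_distrib_left)
  also have "\<dots> = (\<Sum>j\<in>UNIV. \<Sum>i\<in>UNIV. cnj (x $ i) * (A $ i $ j * y $ j))"
    by (rule sum.swap)
  also have "\<dots> = cinner (dagger A *v x) y"
    by (simp add: cinner_def dagger_def matrix_vector_mult_def sum_distrib_left sum_distrib_right mult_ac)
  finally show ?thesis .
qed

lemma cinner_diff_right: "cinner x (y - z) = cinner x y - cinner x z"
  by (simp add: cinner_def right_diff_distrib sum_subtractf)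

lemma cinner_diff_left: "cinner (x - y) z = cinner x z - cinner y z"
  by (simp add: cinner_def left_diff_distrib sum_subtractf)

lemma cinner_cnj: "cnj (cinner x y) = cinner y x"
  by (simp add: cinner_def mult.commute)

text \<open>On the diagonal the form is the sum of the squared moduli of the coordinates, and each
  term of a vanishing sum of nonnegative reals is zero.\<close>

lemma cinner_self_eq_0: "cinner x x = 0 \<Longrightarrow> x = 0"
proof -
  assume "cinner x x = 0"
  then have "of_real (\<Sum>i\<in>UNIV. (cmod (x $ i))\<^sup>2) = (0::complex)"
    by (simp add: cinner_def complex_norm_square mult.commute del: of_real_eq_0_iff of_real_power)
  then have "(\<Sum>i\<in>UNIV. (cmod (x $ i))\<^sup>2) = 0"
    by (simp only: of_real_eq_0_iff)
  then show "x = 0"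
    by (simp add: sum_nonneg_eq_0_iff vec_eq_iff)
qed

text \<open>Gives access to real orthogonal decompositions when a complex projector is constructed
  below.\<close>

lemma Re_cinner: "Re (cinner x y) = x \<bullet> y"
  by (simp add: cinner_def inner_vec_def inner_complex_def)

lemma cinner_scale_right: "cinner x (c *s y) = c * cinner x y"
  by (simp add: cinner_def sum_distrib_left mult_ac)

section \<open>Spectral data under unitary conjugation\<close>

lemma unitary_cancel:
  assumes "unitary W"
  shows "dagger W *v (W *v x) = x" and "W *v (dagger W *v x) = x"
  using assms by (simp_all add: unitary_def matrix_vector_mul_assoc)

lemma unitary_dagger: "unitary W \<Longrightarrow> unitary (dagger W)"
  by (simp add: unitary_def)

lemma conj_dagger_conj:
  assumes "unitary W"
  shows "dagger W ** (W ** A ** dagger W) ** dagger (dagger W) = A"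
proof -
  have "dagger W ** (W ** A ** dagger W) ** dagger (dagger W)
      = (dagger W ** W) ** A ** (dagger W ** W)"
    by (simp add: matrix_mul_assoc)
  then show ?thesis
    using assms by (simp add: unitary_def)
qed

lemma eigenvector_conj:
  assumes "unitary W" and "A *v v = c *s v"
  shows "(W ** A ** dagger W) *v (W *v v) = c *s (W *v v)"
  using assms
  by (simp add: matrix_vector_mul_assoc [symmetric] unitary_cancel vector_scalar_commute)

text \<open>\<open>W\<close> carries eigenvectors to eigenvectors of the conjugated matrix. The
  converse inclusion is the same fact for \<open>dagger W\<close>, since conjugating back recovers
  \<open>A\<close>.\<close>

lemma eigenspace_conj:
  assumes "unitary W"
  shows "eigenspace (W ** A ** dagger W) \<eta> = (*v) W ` eigenspace A \<eta>"
proof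
  show "(*v) W ` eigenspace A \<eta> \<subseteq> eigenspace (W ** A ** dagger W) \<eta>"
    using eigenvector_conj [OF assms] by (auto simp: eigenspace_def)
  show "eigenspace (W ** A ** dagger W) \<eta> \<subseteq> (*v) W ` eigenspace A \<eta>"
  proof
    fix v assume "v \<in> eigenspace (W ** A ** dagger W) \<eta>"
    then have "dagger W *v v \<in> eigenspace A \<eta>"
      using eigenvector_conj [OF unitary_dagger [OF assms], of "W ** A ** dagger W" v]
      by (simp only: eigenspace_def mem_Collect_eq conj_dagger_conj [OF assms])
    then show "v \<in> (*v) W ` eigenspace A \<eta>"
      by (rule rev_image_eqI) (simp add: unitary_cancel [OF assms])
  qed
qed

lemma eigenvalues_alt: "eigenvalues A = {\<eta>. \<exists>v\<in>eigenspace A \<eta>. v \<noteq> 0}"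
  by (auto simp: eigenvalues_def eigenspace_def)

lemma unitary_mult_eq_0_iff: "unitary W \<Longrightarrow> W *v v = 0 \<longleftrightarrow> v = 0"
  by (metis matrix_vector_mult_0_right unitary_cancel(1))

lemma eigenvalues_conj: "unitary W \<Longrightarrow> eigenvalues (W ** A ** dagger W) = eigenvalues A"
  by (simp add: eigenvalues_alt eigenspace_conj unitary_mult_eq_0_iff)

lemma eigendim_conj:
  assumes "unitary W"
  shows "eigendim (W ** A ** dagger W) \<eta> = eigendim A \<eta>"
proof -
  have "inj ((*v) W)"
    by (metis assms injI unitary_cancel(1))
  then show ?thesis
    unfolding eigendim_def eigenspace_conj [OF assms]
    by (intro vec.dim_image_eq) (auto intro: inj_on_subset)
qed

lemma nonzero_eigenvalues_conj:
  "unitary W \<Longrightarrow> nonzero_eigenvalues (W ** A ** dagger W) = nonzero_eigenvalues A"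
  by (simp add: nonzero_eigenvalues_def eigenvalues_conj eigendim_conj)


section \<open>Orthogonal projectors\<close>

text \<open>A projector fixes its range pointwise, so two projectors with the same range satisfy
  \<open>Q ** P = P\<close> and \<open>P ** Q = Q\<close>. The adjoint of the second identity reads
  \<open>Q ** P = Q\<close>.\<close>

lemma is_orth_projector_unique:
  assumes P: "is_orth_projector P E" and Q: "is_orth_projector Q E"
  shows "P = Q"
proof -
  have absorb: "R ** S = S" if R: "is_orth_projector R E" and S: "is_orth_projector S E" for R S
  proof -
    have "R *v (S *v x) = S *v x" for x
    proof -
      obtain y where "S *v x = R *v y"
        using R S unfolding is_orth_projector_def by blast
      then show ?thesis
        using R by (simp add: is_orth_projector_def matrix_vector_mul_assoc)
    qed
    then show ?thesis
      by (simp add: matrix_eq matrix_vector_mul_assoc [symmetric])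
  qed
  have "P = Q ** P"
    using absorb [OF Q P] by simp
  also have "\<dots> = dagger (P ** Q)"
    using P Q by (simp add: dagger_matrix_mult is_orth_projector_def hermitian_def)
  also have "\<dots> = Q"
    using absorb [OF P Q] Q by (simp add: is_orth_projector_def hermitian_def)
  finally show ?thesis .
qed

lemma orth_projector_eqI: "is_orth_projector P E \<Longrightarrow> orth_projector E = P"
  unfolding orth_projector_def by (rule the_equality) (auto intro: is_orth_projector_unique)

text \<open>Ensures that the description \<open>orth_projector\<close> denotes an actual projector.
  It is built from the real orthogonal decomposition along \<open>E\<close>, which is then shown to
  be complex linear and self-adjoint.\<close>

lemma is_orth_projector_exists:
  fixes E :: "(complex ^ 'n) set"
  assumes E: "vec.subspace E"
  shows "\<exists>P. is_orth_projector P E"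
proof -
  \<comment> \<open>Real scaling is a special case of complex scaling, so the complex subspace
    \<open>E\<close> is also a real one.\<close>
  have scaleR: "c *\<^sub>R x = complex_of_real c *s x" for c and x :: "complex ^ 'n"
    unfolding vec_eq_iff vector_scaleR_component vector_smult_component by (simp add: scaleR_conv_of_real)
  have rE: "subspace E"
    unfolding subspace_def scaleR
    using E by (auto simp: vec.subspace_def)
  have decomp: "\<exists>y. y \<in> E \<and> (\<forall>w\<in>E. cinner (x - y) w = 0)" for x
  proof -
    obtain y z where "y \<in> span E" and z: "\<And>w. w \<in> span E \<Longrightarrow> orthogonal z w" and x: "x = y + z"
      using orthogonal_subspace_decomp_exists [of E x] by blast
    \<comment> \<open>As \<open>E\<close> is closed under multiplication by the imaginary unit, real orthogonality to \<open>E\<close>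
      also kills the imaginary part of the Hermitian inner product.\<close>
    have "cinner z w = 0" if "w \<in> E" for w
    proof (rule complex_eqI)
      have "\<i> *s w \<in> E"
        using E that by (simp add: vec.subspace_scale)
      then have "Re (cinner z (\<i> *s w)) = 0"
        using z rE by (simp add: Re_cinner orthogonal_def span_base)
      then show "Im (cinner z w) = Im 0"
        by (simp add: cinner_scale_right)
      show "Re (cinner z w) = Re 0"
        using z that by (simp add: Re_cinner orthogonal_def span_base)
    qed
    with \<open>y \<in> span E\<close> rE x show ?thesis
      by (auto simp: span_eq_iff [THEN iffD2])
  qed
  then obtain p where pE: "\<And>x. p x \<in> E" and p: "\<And>x w. w \<in> E \<Longrightarrow> cinner (x - p x) w = 0"
    by metis
  \<comment> \<open>This criterion identifies values of \<open>p\<close>; it yields both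
    \<open>p_id\<close> and linearity by checking candidates.\<close>
  have p_unique: "p x = y" if "y \<in> E" and "\<And>w. w \<in> E \<Longrightarrow> cinner (x - y) w = 0" for x y
  proof -
    have d: "p x - y \<in> E"
      using E that(1) pE by (simp add: vec.subspace_diff)
    \<comment> \<open>The vector \<open>p x - y\<close> lies in \<open>E\<close> and is the
      difference of the residuals \<open>x - y\<close> and \<open>x - p x\<close>, hence is
      orthogonal to itself.\<close>
    have "cinner (p x - y) (p x - y) = cinner (x - y) (p x - y) - cinner (x - p x) (p x - y)"
      by (simp add: cinner_diff_left)
    also have "\<dots> = 0"
      using d that(2) p by simp
    finally show ?thesis
      using cinner_self_eq_0 by fastforce
  qed
  have p_id: "p x = x" if "x \<in> E" for x
    using that by (intro p_unique) (simp_all add: cinner_def)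
  have "p (x + y) = p x + p y" for x y
  proof (rule p_unique)
    show "p x + p y \<in> E"
      using E pE by (simp add: vec.subspace_add)
    fix w assume "w \<in> E"
    then show "cinner (x + y - (p x + p y)) w = 0"
      using p [of w x] p [of w y]
      by (simp add: cinner_def algebra_simps sum.distrib sum_subtractf)
  qed
  moreover have "p (c *s x) = c *s p x" for c x
  proof (rule p_unique)
    show "c *s p x \<in> E"
      using E pE by (simp add: vec.subspace_scale)
    fix w assume "w \<in> E"
    have "cinner (c *s x - c *s p x) w = cnj c * cinner (x - p x) w"
      by (simp add: cinner_def algebra_simps sum_distrib_left sum_subtractf)
    then show "cinner (c *s x - c *s p x) w = 0"
      using p [OF \<open>w \<in> E\<close>] by simp
  qed
  ultimately have lin: "Vector_Spaces.linear (*s) (*s) p"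
    by (simp add: Vector_Spaces.linear_iff vec.vector_space_axioms)
  define P where "P = matrix p"
  have P: "P *v x = p x" for x
    using matrix_works [OF lin] by (simp add: P_def)
  \<comment> \<open>Both sides equal \<open>cinner (p x) (p y)\<close>, because the residuals of
    \<open>x\<close> and \<open>y\<close> are orthogonal to \<open>E\<close>.\<close>
  have "cinner x (P *v y) = cinner (P *v x) y" for x y
  proof -
    have "cinner x (p y) = cinner (p x) (p y)"
      using p [OF pE, of x y] by (simp add: cinner_diff_left)
    moreover have "cinner (p x) y = cinner (p x) (p y)"
      using arg_cong [OF p [OF pE, of y x], of cnj]
      by (simp add: cinner_cnj cinner_diff_right)
    ultimately show ?thesis
      by (simp add: P)
  qed
  then have sym: "cinner (dagger P *v x - P *v x) y = 0" for x y
    by (simp add: cinner_dagger cinner_diff_left)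
  have "hermitian P"
    using cinner_self_eq_0 [OF sym] by (simp add: hermitian_def matrix_eq)
  moreover have "P ** P = P"
    by (simp add: matrix_eq matrix_vector_mul_assoc [symmetric] P p_id pE)
  moreover have "range ((*v) P) = E"
    unfolding P using pE p_id by (metis image_subset_iff rangeI subsetI subset_antisym)
  ultimately show ?thesis
    unfolding is_orth_projector_def by blast
qed

text \<open>The inner factor \<open>dagger W ** W\<close> cancels, which gives idempotence;
  \<open>dagger W\<close> is surjective, so the range is the image under \<open>W\<close> of the
  range of \<open>P\<close>.\<close>

lemma is_orth_projector_conj:
  assumes W: "unitary W" and P: "is_orth_projector P E"
  shows "is_orth_projector (W ** P ** dagger W) ((*v) W ` E)"
proof -
  have "hermitian (W ** P ** dagger W)"
    using P by (simp add: hermitian_def is_orth_projector_def dagger_matrix_mult matrix_mul_assoc)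
  moreover have "(W ** P ** dagger W) ** (W ** P ** dagger W) = W ** P ** dagger W"
  proof -
    have "(W ** P ** dagger W) ** (W ** P ** dagger W) = W ** P ** (dagger W ** W) ** P ** dagger W"
      by (simp add: matrix_mul_assoc)
    also have "\<dots> = W ** (P ** P) ** dagger W"
      using W by (simp add: unitary_def matrix_mul_assoc)
    finally show ?thesis
      using P by (simp add: is_orth_projector_def)
  qed
  moreover have "range ((*v) (W ** P ** dagger W)) = (*v) W ` E"
  proof -
    have "surj ((*v) (dagger W))"
      by (metis W surjI unitary_cancel(1))
    moreover have "(*v) (W ** P ** dagger W) = (*v) W \<circ> (*v) P \<circ> (*v) (dagger W)"
      by (simp add: fun_eq_iff matrix_vector_mul_assoc matrix_mul_assoc)
    ultimately have "range ((*v) (W ** P ** dagger W)) = (*v) W ` range ((*v) P)"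
      by (simp only: image_comp [symmetric])
    then show ?thesis
      using P by (simp add: is_orth_projector_def)
  qed
  ultimately show ?thesis
    by (simp add: is_orth_projector_def)
qed

lemma subspace_eigenspace: "vec.subspace (eigenspace A \<eta>)"
  by (auto simp: vec.subspace_def eigenspace_def matrix_vector_right_distrib vector_scalar_commute
      vector_add_ldistrib mult.commute)

text \<open>Existence supplies a projector \<open>P\<close> for the eigenspace of \<open>A\<close>;
  its conjugate projects onto the transported eigenspace, and uniqueness evaluates both
  descriptions.\<close>

lemma spectral_part_conj:
  assumes "unitary W"
  shows "spectral_part (W ** A ** dagger W) \<eta> = W ** spectral_part A \<eta> ** dagger W"
proof -
  obtain P where P: "is_orth_projector P (eigenspace A \<eta>)"
    using is_orth_projector_exists [OF subspace_eigenspace] by blast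
  have "orth_projector (eigenspace (W ** A ** dagger W) \<eta>) = W ** P ** dagger W"
    unfolding eigenspace_conj [OF assms]
    by (rule orth_projector_eqI [OF is_orth_projector_conj [OF assms P]])
  then show ?thesis
    by (simp add: spectral_part_def orth_projector_eqI [OF P] matrix_scalar_ac
        scalar_matrix_assoc [symmetric])
qed


section \<open>Tensor products and partial traces\<close>

lemma dagger_tensor: "dagger (A \<otimes> B) = dagger A \<otimes> dagger B"
  by (simp add: dagger_def tensor_def vec_eq_iff)

text \<open>Each entry of the product is a sum over index pairs of a separated term, which factors
  into a product of two sums.\<close>

lemma tensor_matrix_mult: "(A \<otimes> B) ** (C \<otimes> D) = (A ** C) \<otimes> (B ** D)"
  by (simp add: tensor_def matrix_matrix_mult_def vec_eq_iff sum_product sum.cartesian_product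
      UNIV_Times_UNIV [symmetric] case_prod_unfold mult_ac del: UNIV_Times_UNIV)

lemma tensor_mat_1: "mat 1 \<otimes> mat 1 = mat 1"
  by (auto simp: tensor_def mat_def vec_eq_iff prod_eq_iff)

lemma unitary_tensor: "unitary A \<Longrightarrow> unitary B \<Longrightarrow> unitary (A \<otimes> B)"
  by (simp add: unitary_def dagger_tensor tensor_matrix_mult tensor_mat_1)

section \<open>Partial traces of conjugated operators\<close>

lemma sum_UNIV_prod:
  "(\<Sum>p\<in>UNIV. f p) = (\<Sum>i\<in>UNIV. \<Sum>j\<in>UNIV. f (i, j))"
  by (simp add: sum.cartesian_product UNIV_Times_UNIV)

text \<open>This is the entrywise form of \<open>dagger U ** U = mat 1\<close>, arranged as it
  appears when the traced index is summed.\<close>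

lemma unitary_columns:
  assumes "unitary U"
  shows "(\<Sum>j\<in>UNIV. U $ j $ k * cnj (U $ j $ l)) = (if k = l then 1 else 0)"
proof -
  have "(dagger U ** U) $ l $ k = mat 1 $ l $ k"
    using assms by (simp add: unitary_def)
  then show ?thesis
    by (auto simp: dagger_def matrix_matrix_mult_def mat_def mult.commute)
qed

text \<open>Summing over the traced index \<open>j\<close> pairs two columns of \<open>B\<close>;
  their orthonormality removes \<open>B\<close>, leaving the conjugation by
  \<open>A\<close>.\<close>

lemma Tr_B_conj:
  assumes "unitary B"
  shows "Tr_B ((A \<otimes> B) ** R ** dagger (A \<otimes> B)) = A ** Tr_B R ** dagger A"
proof -
  have "Tr_B ((A \<otimes> B) ** R ** dagger (A \<otimes> B)) $ i $ k = (A ** Tr_B R ** dagger A) $ i $ k" for i k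
  proof -
    let ?t = "\<lambda>m n a b. A $ i $ a * R $ (a, b) $ (m, n) * cnj (A $ k $ m)"
    have "Tr_B ((A \<otimes> B) ** R ** dagger (A \<otimes> B)) $ i $ k =
      (\<Sum>j\<in>UNIV. \<Sum>m\<in>UNIV. \<Sum>n\<in>UNIV. \<Sum>a\<in>UNIV. \<Sum>b\<in>UNIV. ?t m n a b * (B $ j $ b * cnj (B $ j $ n)))"
      by (simp add: Tr_B_def tensor_def dagger_def matrix_matrix_mult_def sum_UNIV_prod
          sum_distrib_left sum_distrib_right mult_ac)
    \<comment> \<open>The sum over \<open>j\<close> moves past the other four, so that it meets only
      the entries of \<open>B\<close>.\<close>
    also have "\<dots> = (\<Sum>m\<in>UNIV. \<Sum>n\<in>UNIV. \<Sum>a\<in>UNIV. \<Sum>b\<in>UNIV. \<Sum>j\<in>UNIV.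
        ?t m n a b * (B $ j $ b * cnj (B $ j $ n)))"
      by (rule trans [OF sum.swap], rule sum.cong [OF refl],
          rule trans [OF sum.swap], rule sum.cong [OF refl],
          rule trans [OF sum.swap], rule sum.cong [OF refl], rule sum.swap)
    \<comment> \<open>Column orthonormality keeps only \<open>b = n\<close>.\<close>
    also have "\<dots> = (\<Sum>m\<in>UNIV. \<Sum>n\<in>UNIV. \<Sum>a\<in>UNIV. ?t m n a n)"
      by (simp add: sum_distrib_left [symmetric] unitary_columns [OF assms] if_distrib cong: if_cong)
    also have "\<dots> = (\<Sum>m\<in>UNIV. \<Sum>a\<in>UNIV. \<Sum>n\<in>UNIV. ?t m n a n)"
      by (rule sum.cong [OF refl], rule sum.swap)
    also have "\<dots> = (A ** Tr_B R ** dagger A) $ i $ k"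
      by (simp add: Tr_B_def dagger_def matrix_matrix_mult_def sum_distrib_right sum_distrib_left mult_ac)
    finally show ?thesis .
  qed
  then show ?thesis
    by (simp add: vec_eq_iff)
qed

text \<open>The roles of the factors are exchanged: orthonormal columns of \<open>A\<close> collapse
  the sum over the traced index.\<close>

lemma Tr_A_conj:
  assumes "unitary A"
  shows "Tr_A ((A \<otimes> B) ** R ** dagger (A \<otimes> B)) = B ** Tr_A R ** dagger B"
proof -
  have "Tr_A ((A \<otimes> B) ** R ** dagger (A \<otimes> B)) $ j $ l = (B ** Tr_A R ** dagger B) $ j $ l" for j l
  proof -
    let ?t = "\<lambda>m n a b. B $ j $ b * R $ (a, b) $ (m, n) * cnj (B $ l $ n)"
    have "Tr_A ((A \<otimes> B) ** R ** dagger (A \<otimes> B)) $ j $ l =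
      (\<Sum>i\<in>UNIV. \<Sum>m\<in>UNIV. \<Sum>n\<in>UNIV. \<Sum>a\<in>UNIV. \<Sum>b\<in>UNIV. ?t m n a b * (A $ i $ a * cnj (A $ i $ m)))"
      by (simp add: Tr_A_def tensor_def dagger_def matrix_matrix_mult_def sum_UNIV_prod
          sum_distrib_left sum_distrib_right mult_ac)
    also have "\<dots> = (\<Sum>m\<in>UNIV. \<Sum>n\<in>UNIV. \<Sum>a\<in>UNIV. \<Sum>b\<in>UNIV. \<Sum>i\<in>UNIV.
        ?t m n a b * (A $ i $ a * cnj (A $ i $ m)))"
      by (rule trans [OF sum.swap], rule sum.cong [OF refl],
          rule trans [OF sum.swap], rule sum.cong [OF refl],
          rule trans [OF sum.swap], rule sum.cong [OF refl], rule sum.swap)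
    \<comment> \<open>The surviving term will be \<open>a = m\<close>, so the sum over
      \<open>a\<close> is brought next to the sum over \<open>i\<close>.\<close>
    also have "\<dots> = (\<Sum>m\<in>UNIV. \<Sum>n\<in>UNIV. \<Sum>b\<in>UNIV. \<Sum>a\<in>UNIV. \<Sum>i\<in>UNIV.
        ?t m n a b * (A $ i $ a * cnj (A $ i $ m)))"
      by (rule sum.cong [OF refl], rule sum.cong [OF refl], rule sum.swap)
    also have "\<dots> = (\<Sum>m\<in>UNIV. \<Sum>n\<in>UNIV. \<Sum>b\<in>UNIV. ?t m n m b)"
      by (simp add: sum_distrib_left [symmetric] unitary_columns [OF assms] if_distrib cong: if_cong)
    also have "\<dots> = (\<Sum>n\<in>UNIV. \<Sum>m\<in>UNIV. \<Sum>b\<in>UNIV. ?t m n m b)"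
      by (rule sum.swap)
    also have "\<dots> = (\<Sum>n\<in>UNIV. \<Sum>b\<in>UNIV. \<Sum>m\<in>UNIV. ?t m n m b)"
      by (rule sum.cong [OF refl], rule sum.swap)
    also have "\<dots> = (B ** Tr_A R ** dagger B) $ j $ l"
      by (simp add: Tr_A_def dagger_def matrix_matrix_mult_def sum_distrib_right sum_distrib_left mult_ac)
    finally show ?thesis .
  qed
  then show ?thesis
    by (simp add: vec_eq_iff)
qed


section \<open>Invariance of \<open>M\<close>\<close>

theorem mainTheorem7:
  fixes \<rho> :: "complex ^ ('a::finite \<times> 'b::finite) ^ ('a \<times> 'b)"
    and U\<^sub>A :: "complex ^ 'a ^ 'a" and U\<^sub>B :: "complex ^ 'b ^ 'b"
  assumes "density_matrix \<rho>" and "unitary U\<^sub>A" and "unitary U\<^sub>B"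
  shows "M ((U\<^sub>A \<otimes> U\<^sub>B) ** \<rho> ** dagger (U\<^sub>A \<otimes> U\<^sub>B)) = M \<rho>"
  \<comment> \<open>The index set \<open>eigenvalues\<close>, the dimensions \<open>eigendim\<close>
    and the spectra of the reduced spectral parts agree on both sides, so the sums agree term by
    term.\<close>
  using assms(2,3)
  by (simp add: M_def M_A_def M_B_def unitary_tensor eigenvalues_conj eigendim_conj
      spectral_part_conj Tr_A_conj Tr_B_conj nonzero_eigenvalues_conj)

end
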